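(* Let $\{T_i\}_{i\in I}$ be a $p$-frame associated to $(a_2,\dots,a_n)$ for $X$ with bounds $A,B$, and let $\{R_i\}_{i\in I}\subseteq X_F^{*}$ be any sequence such that, for all $x\in X$, $$\sum_{i\in I}\big|T_i(x,a_2,\dots,a_n)-R_i(x,a_2,\dots,a_n)\big|^p\le\alpha\sum_{i\in I}|T_i(x,a_2,\dots,a_n)|^p+\beta\,\|x,a_2,\dots,a_n\|_X^p,$$ where $\alpha,\beta\ge0$ with $0\le\alpha+\frac{\beta}{A}<1$. Then $\{R_i\}_{i\in I}$ is a $p$-frame associated to $(a_2,\dots,a_n)$ for $X$.
   Context: Let $\mathbb K\in\{\mathbb R,\mathbb C\}$, $n\ge 2$, $p\in(1,\infty)$, and let $I$ be a countable index set. An $n$-norm on a linear space $X$ over $\mathbb K$ is a map $\|\cdot,\dots,\cdot\|_X:X^n\to\mathbb R$ such that (i) $\|x_1,\dots,x_n\|_X=0$ iff $x_1,\dots,x_n$ are linearly dependent; (ii) it is invariant under permutations of its arguments; (iii) $\|\alpha x_1,x_2,\dots,x_n\|_X=|\alpha|\,\|x_1,\dots,x_n\|_X$ for $\alpha\in\mathbb K$; (iv) $\|x+y,x_2,\dots,x_n\|_X\le\|x,x_2,\dots,x_n\|_X+\|y,x_2,\dots,x_n\|_X$. A sequence $\{x_k\}$ converges to $x$ if $\|x_k-x,x_2,\dots,x_n\|_X\to0$ for all $x_2,\dots,x_n\in X$, and is Cauchy if $\|x_l-x_k,x_2,\dots,x_n\|_X\to0$ as $l,k\to\infty$ for all $x_2,\dots,x_n\in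 X$; $X$ is an $n$-Banach space if every Cauchy sequence converges. $X$ is an $n$-Banach space and $a_2,\dots,a_n\in X$ are fixed. A bounded $b$-linear functional on $X\times\langle a_2\rangle\times\cdots\times\langle a_n\rangle$ ($\langle a_i\rangle$ is the subspace generated by $a_i$) is a map $T$ from this set to $\mathbb K$ with $T(x+y,a_2,\dots,a_n)=T(x,a_2,\dots,a_n)+T(y,a_2,\dots,a_n)$, $T(kx,a_2,\dots,a_n)=kT(x,a_2,\dots,a_n)$ for $x,y\in X$, $k\in\mathbb K$, and for which there is $M>0$ with $|T(x,a_2,\dots,a_n)|\le M\|x,a_2,\dots,a_n\|_X$ for all $x\in X$. $X_F^{*}$ is the space of all of these. A countable family $\{T_i\}_{i\in I}\subseteq X_F^{*}$ is a $p$-frame associated to $(a_2,\dots,a_n)$ for $X$ (with bounds $A,B$) if there are constants $A,B>0$ with $A\|x,a_2,\dots,a_n\|_X^p\le\sum_{i\in I}|T_i(x,a_2,\dots,a_n)|^p\le B\|x,a_2,\dots,a_n\|_X^p$ for all $x\in X$. *)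

theory Defs
  imports "HOL-Analysis.Analysis" "HOL-Combinatorics.Permutations"
begin

text \<open>
  The scalar field is a type of class \<open>real_normed_field\<close>. Its instances include \<open>real\<close> and
  \<open>complex\<close>, and by the theorem of Mazur every other instance is isometrically isomorphic to one of
  these two. Elements of \<open>X\<^sup>n\<close> are lists of length \<open>n\<close>; the fixed tuple
  \<open>(a\<^sub>2, \<dots>, a\<^sub>n)\<close> is a list \<open>a\<close> of length \<open>n - 1\<close>.
\<close>

text \<open>Linear dependence of a tuple, so that a tuple with a repeated entry is dependent.\<close>

definition lin_dependent :: "('k::field \<Rightarrow> 'x::ab_group_add \<Rightarrow> 'x) \<Rightarrow> 'x list \<Rightarrow> bool" where
  "lin_dependent smul xs \<longleftrightarrow>
     (\<exists>c :: nat \<Rightarrow> 'k. (\<exists>i<length xs. c i \<noteq> 0) \<and>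
        (\<Sum>i<length xs. smul (c i) (xs ! i)) = 0)"

locale n_normed_space = vector_space smul
  for smul :: "'k::real_normed_field \<Rightarrow> 'x::ab_group_add \<Rightarrow> 'x" +
  fixes n :: nat and N :: "'x list \<Rightarrow> real"
  assumes n_norm_eq_0_iff: "length xs = n \<Longrightarrow> N xs = 0 \<longleftrightarrow> lin_dependent smul xs"
    and n_norm_permute: "length xs = n \<Longrightarrow> \<sigma> permutes {..<n} \<Longrightarrow> N (permute_list \<sigma> xs) = N xs"
    and n_norm_scale: "length (x # xs) = n \<Longrightarrow> N (smul \<alpha> x # xs) = norm \<alpha> * N (x # xs)"
    and n_norm_triangle: "length (x # xs) = n \<Longrightarrow> N ((x + y) # xs) \<le> N (x # xs) + N (y # xs)"

definition n_converges :: "nat \<Rightarrow> ('x::ab_group_add list \<Rightarrow> real) \<Rightarrow> (nat \<Rightarrow> 'x) \<Rightarrow> 'x \<Rightarrow> bool" where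
  "n_converges n N s x \<longleftrightarrow>
     (\<forall>xs. length xs = n - 1 \<longrightarrow> (\<lambda>k. N ((s k - x) # xs)) \<longlonglongrightarrow> 0)"

definition n_Cauchy :: "nat \<Rightarrow> ('x::ab_group_add list \<Rightarrow> real) \<Rightarrow> (nat \<Rightarrow> 'x) \<Rightarrow> bool" where
  "n_Cauchy n N s \<longleftrightarrow>
     (\<forall>xs. length xs = n - 1 \<longrightarrow>
        ((\<lambda>(l, k). N ((s l - s k) # xs)) \<longlongrightarrow> 0) (sequentially \<times>\<^sub>F sequentially))"

locale n_banach_space = n_normed_space +
  assumes n_complete: "n_Cauchy n N s \<Longrightarrow> \<exists>x. n_converges n N s x"

text \<open>The set \<open>X \<times> \<langle>a\<^sub>2\<rangle> \<times> \<dots> \<times> \<langle>a\<^sub>n\<rangle>\<close>.\<close>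

definition b_domain :: "('k::field \<Rightarrow> 'x::ab_group_add \<Rightarrow> 'x) \<Rightarrow> 'x list \<Rightarrow> 'x list set" where
  "b_domain smul a = {x # ys | x ys. list_all2 (\<lambda>y b. y \<in> module.span smul {b}) ys a}"

text \<open>
  The space \<open>X\<^sub>F\<^sup>*\<close>. Maps defined on \<open>b_domain smul a\<close> only are represented by extensional
  functions. Additivity, homogeneity and boundedness are required only at the tuples
  \<open>(x, a\<^sub>2, \<dots>, a\<^sub>n)\<close>.
\<close>

definition bounded_b_linear_functionals ::
  "('k::real_normed_field \<Rightarrow> 'x::ab_group_add \<Rightarrow> 'x) \<Rightarrow> ('x list \<Rightarrow> real) \<Rightarrow> 'x list \<Rightarrow>
     ('x list \<Rightarrow> 'k) set" where
  "bounded_b_linear_functionals smul N a =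
     {T \<in> extensional (b_domain smul a).
        (\<forall>x y. T ((x + y) # a) = T (x # a) + T (y # a)) \<and>
        (\<forall>k x. T (smul k x # a) = k * T (x # a)) \<and>
        (\<exists>M>0. \<forall>x. norm (T (x # a)) \<le> M * N (x # a))}"

text \<open>
  The series of non-negative terms is taken in \<open>[0, \<infinity>]\<close>, so the upper bound expresses in
  particular that it converges.
\<close>

definition p_frame_bounds ::
  "('k::real_normed_field \<Rightarrow> 'x::ab_group_add \<Rightarrow> 'x) \<Rightarrow> ('x list \<Rightarrow> real) \<Rightarrow> 'x list \<Rightarrow>
     real \<Rightarrow> 'i set \<Rightarrow> ('i \<Rightarrow> 'x list \<Rightarrow> 'k) \<Rightarrow> real \<Rightarrow> real \<Rightarrow> bool" where
  "p_frame_bounds smul N a p I T A B \<longleftrightarrow>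
     countable I \<and> (\<forall>i\<in>I. T i \<in> bounded_b_linear_functionals smul N a) \<and> A > 0 \<and> B > 0 \<and>
     (\<forall>x. ennreal (A * N (x # a) powr p) \<le> (\<Sum>\<^sub>\<infinity>i\<in>I. ennreal (norm (T i (x # a)) powr p)) \<and>
          (\<Sum>\<^sub>\<infinity>i\<in>I. ennreal (norm (T i (x # a)) powr p)) \<le> ennreal (B * N (x # a) powr p))"

definition p_frame ::
  "('k::real_normed_field \<Rightarrow> 'x::ab_group_add \<Rightarrow> 'x) \<Rightarrow> ('x list \<Rightarrow> real) \<Rightarrow> 'x list \<Rightarrow>
     real \<Rightarrow> 'i set \<Rightarrow> ('i \<Rightarrow> 'x list \<Rightarrow> 'k) \<Rightarrow> bool" where
  "p_frame smul N a p I T \<longleftrightarrow> (\<exists>A B. p_frame_bounds smul N a p I T A B)"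

end

theory Submission imports Defs begin

text \<open>
  Fix \<open>x\<close> and write \<open>u = N (x # a) powr p\<close>, and \<open>t\<close>, \<open>r\<close>, \<open>d\<close> for the sums of
  \<open>|T\<^sub>i|\<^sup>p\<close>, \<open>|R\<^sub>i|\<^sup>p\<close>, \<open>|T\<^sub>i - R\<^sub>i|\<^sup>p\<close> at \<open>(x, a\<^sub>2, \<dots>, a\<^sub>n)\<close>. The lower frame bound
  \<open>A u \<le> t\<close> turns the hypothesis into \<open>d \<le> \<kappa> t\<close> with \<open>\<kappa> = \<alpha> + \<beta> / A < 1\<close>, so that
  \<open>T\<close> and \<open>R\<close>, as elements of \<open>\<ell>\<^sup>p\<close>, are at distance at most \<open>\<kappa>\<^bsup>1/p\<^esup> \<parallel>T\<parallel>\<close>, and Minkowski's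
  inequality bounds \<open>r\<close> by multiples of \<open>t\<close> from both sides.

  Minkowski's inequality is replaced by a termwise consequence of the convexity of
  \<open>s \<mapsto> s\<^sup>p\<close>: for each \<open>\<nu> \<in> (0, 1)\<close> there is \<open>C > 0\<close> with
  \<open>|v|\<^sup>p \<le> |v - w|\<^sup>p / \<nu> + C |w|\<^sup>p\<close> (lemma \<open>norm_powr_le_perturbed\<close>). Summation gives
  \<open>t \<le> d / \<nu> + C r\<close> and \<open>r \<le> d / \<nu> + C t\<close>. With \<open>\<kappa> < \<nu> < 1\<close> the first inequality yields
  \<open>(1 - \<kappa> / \<nu>) t \<le> C r\<close>, the second one \<open>r \<le> (\<kappa> / \<nu> + C) t\<close>. The frame bounds of \<open>T\<close> then
  give those of \<open>R\<close>.
\<close>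

text \<open>
  Convexity of \<open>s \<mapsto> s\<^sup>p\<close> applied to \<open>s + t = \<mu> (s / \<mu>) + (1 - \<mu>) (t / (1 - \<mu>))\<close>.
\<close>

lemma powr_add_le_weighted:
  fixes s t \<mu> p :: real
  assumes "p \<ge> 1" "0 < \<mu>" "\<mu> < 1" "s \<ge> 0" "t \<ge> 0"
  shows "(s + t) powr p \<le> s powr p / \<mu> powr (p - 1) + t powr p / (1 - \<mu>) powr (p - 1)"
proof (cases "s = 0 \<or> t = 0")
  case True
  have le_div: "z powr p \<le> z powr p / w powr (p - 1)" if "0 < w" "w < 1" for z w :: real
  proof -
    have "w powr (p - 1) \<le> 1" "w powr (p - 1) > 0"
      using that assms(1) by (auto simp: powr_le1)
    then show ?thesis
      by (simp add: le_divide_eq mult_left_le)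
  qed
  show ?thesis
    using True le_div[of \<mu> s] le_div[of "1 - \<mu>" t] assms by auto
next
  case False
  then have pos: "s > 0" "t > 0"
    using assms by auto
  have weight: "w * (z / w) powr p = z powr p / w powr (p - 1)" if "w > 0" "z > 0" for z w :: real
    using that by (simp add: powr_divide powr_diff)
  have "(s + t) powr p = ((1 - \<mu>) *\<^sub>R (t / (1 - \<mu>)) + \<mu> *\<^sub>R (s / \<mu>)) powr p"
    using assms by (simp add: add.commute)
  also have "\<dots> \<le> (1 - \<mu>) * (t / (1 - \<mu>)) powr p + \<mu> * (s / \<mu>) powr p"
    using powr_convex[OF assms(1)] assms pos
    by (intro convex_onD) auto
  also have "\<dots> = t powr p / (1 - \<mu>) powr (p - 1) + s powr p / \<mu> powr (p - 1)"
    using weight[of "1 - \<mu>" t] weight[of \<mu> s] assms pos by simp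
  finally show ?thesis
    by simp
qed

lemma norm_powr_le_perturbed:
  fixes p \<nu> :: real
  assumes "p > 1" "0 < \<nu>" "\<nu> < 1"
  obtains C where "C > 0"
    "\<And>v w :: 'a::real_normed_vector.
       norm v powr p \<le> (1 / \<nu>) * norm (v - w) powr p + C * norm w powr p"
proof
  \<comment> \<open>The weight for which \<open>\<mu> powr (p - 1) = \<nu>\<close>.\<close>
  define \<mu> where "\<mu> = \<nu> powr (1 / (p - 1))"
  have \<mu>: "0 < \<mu>" "\<mu> < 1"
    using assms powr_less_mono2[of "1 / (p - 1)" \<nu> 1] by (auto simp: \<mu>_def)
  have \<mu>_powr: "\<mu> powr (p - 1) = \<nu>"
    using assms by (simp add: \<mu>_def powr_powr)
  show "1 / (1 - \<mu>) powr (p - 1) > 0"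
    using \<mu> by simp
  fix v w :: 'a
  have "norm v \<le> norm (v - w) + norm w"
    using norm_triangle_ineq[of "v - w" w] by simp
  then have "norm v powr p \<le> (norm (v - w) + norm w) powr p"
    using assms by (intro powr_mono2) auto
  also have "\<dots> \<le> (1 / \<nu>) * norm (v - w) powr p + 1 / (1 - \<mu>) powr (p - 1) * norm w powr p"
    using powr_add_le_weighted[of p \<mu> "norm (v - w)" "norm w"] assms \<mu> \<mu>_powr by simp
  finally show "norm v powr p
      \<le> (1 / \<nu>) * norm (v - w) powr p + 1 / (1 - \<mu>) powr (p - 1) * norm w powr p" .
qed

lemma infsum_cmult_right_ennreal:
  fixes f :: "'a \<Rightarrow> ennreal" and c :: real
  shows "(\<Sum>\<^sub>\<infinity>x\<in>S. ennreal c * f x) = ennreal c * infsum f S"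
proof -
  have "isCont ((*) (ennreal c)) (infsum f S)"
    unfolding isCont_def by (intro ennreal_tendsto_cmult tendsto_ident_at) simp
  then have "infsum ((*) (ennreal c) \<circ> f) S = ennreal c * infsum f S"
    by (intro infsum_comm_additive_general)
       (auto simp: sum_distrib_left intro: nonneg_summable_on_complete)
  then show ?thesis
    by (simp add: o_def)
qed

lemma infsum_ennreal_le_combination:
  fixes f g h :: "'a \<Rightarrow> real"
  assumes "b \<ge> 0" "c \<ge> 0" "\<And>x. g x \<ge> 0" "\<And>x. h x \<ge> 0"
    and le: "\<And>x. x \<in> S \<Longrightarrow> f x \<le> b * g x + c * h x"
  shows "(\<Sum>\<^sub>\<infinity>x\<in>S. ennreal (f x))
    \<le> ennreal b * (\<Sum>\<^sub>\<infinity>x\<in>S. ennreal (g x)) + ennreal c * (\<Sum>\<^sub>\<infinity>x\<in>S. ennreal (h x))"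
proof -
  have summable: "k summable_on S" for k :: "'a \<Rightarrow> ennreal"
    by (simp add: nonneg_summable_on_complete)
  have "(\<Sum>\<^sub>\<infinity>x\<in>S. ennreal (f x)) \<le> (\<Sum>\<^sub>\<infinity>x\<in>S. ennreal b * ennreal (g x) + ennreal c * ennreal (h x))"
  proof (intro infsum_mono summable)
    fix x assume "x \<in> S"
    show "ennreal (f x) \<le> ennreal b * ennreal (g x) + ennreal c * ennreal (h x)"
      using ennreal_leI[OF le[OF \<open>x \<in> S\<close>]] assms(1-4) by (simp add: ennreal_plus ennreal_mult)
  qed
  also have "\<dots> = ennreal b * (\<Sum>\<^sub>\<infinity>x\<in>S. ennreal (g x)) + ennreal c * (\<Sum>\<^sub>\<infinity>x\<in>S. ennreal (h x))"
    by (simp add: infsum_add summable infsum_cmult_right_ennreal)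
  finally show ?thesis .
qed

theorem theorem5p1:
  fixes smul :: "'k::real_normed_field \<Rightarrow> 'x::ab_group_add \<Rightarrow> 'x"
    and n :: nat and N :: "'x list \<Rightarrow> real" and a :: "'x list"
    and p :: real and I :: "'i set"
    and T R :: "'i \<Rightarrow> 'x list \<Rightarrow> 'k"
    and A B \<alpha> \<beta> :: real
  assumes "n \<ge> 2"
    and "n_banach_space smul n N"
    and "length a = n - 1"
    and "p > 1"
    and "countable I"
    and "p_frame_bounds smul N a p I T A B"
    and "\<forall>i\<in>I. R i \<in> bounded_b_linear_functionals smul N a"
    and "\<alpha> \<ge> 0" and "\<beta> \<ge> 0"
    and "0 \<le> \<alpha> + \<beta> / A" and "\<alpha> + \<beta> / A < 1"
    and "\<forall>x. (\<Sum>\<^sub>\<infinity>i\<in>I. ennreal (norm (T i (x # a) - R i (x # a)) powr p))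
           \<le> ennreal \<alpha> * (\<Sum>\<^sub>\<infinity>i\<in>I. ennreal (norm (T i (x # a)) powr p))
              + ennreal (\<beta> * N (x # a) powr p)"
  shows "p_frame smul N a p I R"
proof -
  define \<kappa> where "\<kappa> = \<alpha> + \<beta> / A"
  \<comment> \<open>Any number strictly between \<open>\<kappa>\<close> and \<open>1\<close> would do.\<close>
  define \<nu> where "\<nu> = (1 + \<kappa>) / 2"
  have A: "A > 0" and B: "B > 0"
    using assms(6) by (auto simp: p_frame_bounds_def)
  have \<kappa>: "0 \<le> \<kappa>" "\<kappa> < 1"
    using assms(10,11) by (simp_all add: \<kappa>_def)
  then have \<nu>: "0 < \<nu>" "\<nu> < 1" "\<kappa> < \<nu>"
    by (simp_all add: \<nu>_def)
  obtain C where C: "C > 0"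
    and C_le: "\<And>v w :: 'k. norm v powr p \<le> (1 / \<nu>) * norm (v - w) powr p + C * norm w powr p"
    using norm_powr_le_perturbed[OF \<open>p > 1\<close> \<nu>(1,2), where 'a = 'k] by blast
  define A' B' where "A' = (1 - \<kappa> / \<nu>) / C * A" and "B' = (\<kappa> / \<nu> + C) * B"
  have gap: "1 - \<kappa> / \<nu> > 0"
    using \<nu> by simp
  have A': "A' > 0" and B': "B' > 0"
    using A B C \<kappa> \<nu> gap by (simp_all add: A'_def B'_def add_nonneg_pos)
  have "ennreal (A' * N (x # a) powr p) \<le> (\<Sum>\<^sub>\<infinity>i\<in>I. ennreal (norm (R i (x # a)) powr p)) \<and>
        (\<Sum>\<^sub>\<infinity>i\<in>I. ennreal (norm (R i (x # a)) powr p)) \<le> ennreal (B' * N (x # a) powr p)" for x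
  proof -
    define u where "u = N (x # a) powr p"
    define t where "t = (\<Sum>\<^sub>\<infinity>i\<in>I. ennreal (norm (T i (x # a)) powr p))"
    define r where "r = (\<Sum>\<^sub>\<infinity>i\<in>I. ennreal (norm (R i (x # a)) powr p))"
    define d where "d = (\<Sum>\<^sub>\<infinity>i\<in>I. ennreal (norm (T i (x # a) - R i (x # a)) powr p))"
    have u: "u \<ge> 0"
      by (simp add: u_def)
    have t_bounds: "ennreal (A * u) \<le> t" "t \<le> ennreal (B * u)"
      using assms(6) by (auto simp: p_frame_bounds_def u_def t_def)
    have d_le: "d \<le> ennreal \<alpha> * t + ennreal (\<beta> * u)"
      using assms(12) by (simp add: u_def t_def d_def)
    have t_le: "t \<le> ennreal (1 / \<nu>) * d + ennreal C * r"
      unfolding t_def d_def r_def using C \<nu> by (intro infsum_ennreal_le_combination C_le) auto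
    have r_le: "r \<le> ennreal (1 / \<nu>) * d + ennreal C * t"
      unfolding t_def d_def r_def using C \<nu> C_le
      by (intro infsum_ennreal_le_combination) (auto simp: norm_minus_commute)

    \<comment> \<open>All three sums are finite, so the estimates can be carried out in the reals.\<close>
    obtain t' where t': "t = ennreal t'" "t' \<ge> 0"
      using t_bounds(2) by (cases t) (auto simp: top_unique)
    have t'_bounds: "A * u \<le> t'" "t' \<le> B * u"
      using t_bounds t' A B u by (simp_all add: ennreal_le_iff)
    have "\<beta> * u \<le> \<beta> / A * t'"
      using mult_left_mono[OF t'_bounds(1), of "\<beta> / A"] A \<open>\<beta> \<ge> 0\<close> by simp
    then have "\<alpha> * t' + \<beta> * u \<le> \<kappa> * t'"
      by (simp add: \<kappa>_def algebra_simps)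
    moreover have "d \<le> ennreal (\<alpha> * t' + \<beta> * u)"
      using d_le t' u \<open>\<alpha> \<ge> 0\<close> \<open>\<beta> \<ge> 0\<close> by (simp add: ennreal_plus ennreal_mult)
    ultimately have "d \<le> ennreal (\<kappa> * t')"
      using ennreal_leI order_trans by blast
    then have "ennreal (1 / \<nu>) * d \<le> ennreal (1 / \<nu>) * ennreal (\<kappa> * t')"
      by (rule mult_left_mono) simp
    also have "\<dots> = ennreal (\<kappa> / \<nu> * t')"
      using \<nu> \<kappa> t'(2) by (simp flip: ennreal_mult)
    finally have d_le': "ennreal (1 / \<nu>) * d \<le> ennreal (\<kappa> / \<nu> * t')" .
    have "r \<le> ennreal (\<kappa> / \<nu> * t') + ennreal C * t"
      using r_le d_le' by (meson add_right_mono order_trans)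
    also have "\<dots> = ennreal ((\<kappa> / \<nu> + C) * t')"
      using t' C \<kappa> \<nu> by (simp add: distrib_right ennreal_plus ennreal_mult)
    finally have r_le': "r \<le> ennreal ((\<kappa> / \<nu> + C) * t')" .
    then obtain r' where r': "r = ennreal r'" "r' \<ge> 0"
      by (cases r) (auto simp: top_unique)

    have "t \<le> ennreal (\<kappa> / \<nu> * t') + ennreal C * r"
      using t_le d_le' by (meson add_right_mono order_trans)
    also have "\<dots> = ennreal (\<kappa> / \<nu> * t' + C * r')"
      using t' r' C \<kappa> \<nu> by (simp add: ennreal_plus ennreal_mult)
    finally have "ennreal t' \<le> ennreal (\<kappa> / \<nu> * t' + C * r')"
      unfolding t' .
    moreover have "\<kappa> / \<nu> * t' + C * r' \<ge> 0"
      using t'(2) r'(2) C \<kappa> \<nu> by simp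
    ultimately have "t' \<le> \<kappa> / \<nu> * t' + C * r'"
      by (simp only: ennreal_le_iff)
    then have "(1 - \<kappa> / \<nu>) * t' \<le> C * r'"
      by (simp add: algebra_simps)
    moreover have "(1 - \<kappa> / \<nu>) * (A * u) \<le> (1 - \<kappa> / \<nu>) * t'"
      using t'_bounds(1) gap by (intro mult_left_mono) auto
    ultimately have "A' * u \<le> r'"
      using C by (simp add: A'_def divide_le_eq mult.assoc mult.commute[of r'])
    then have lower: "ennreal (A' * u) \<le> r"
      using r' ennreal_leI by simp

    have "(\<kappa> / \<nu> + C) * t' \<le> (\<kappa> / \<nu> + C) * (B * u)"
      using t'_bounds(2) \<kappa> \<nu> C by (intro mult_left_mono) auto
    then have "r \<le> ennreal (B' * u)"
      using r_le' ennreal_leI order_trans by (fastforce simp: B'_def mult.assoc)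
    with lower show ?thesis
      by (simp add: u_def r_def)
  qed
  then have "p_frame_bounds smul N a p I R A' B'"
    using A' B' assms(5,7) by (auto simp: p_frame_bounds_def)
  then show ?thesis
    unfolding p_frame_def by blast
qed

end
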